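(* Let $X$ be a real Banach space and let $K\subset X^*$ be $w^*$ compact and non-empty. For any ordinal $\xi$, the following are equivalent: (i) There exists $\varepsilon>0$ such that $Sz_\varepsilon(K)>\xi$. (ii) There exists $\varepsilon>0$ such that $o_w(\mathcal{H}^K_\varepsilon)>\xi$. (iii) There exist $0<\delta<\varepsilon$ such that $o_{(K,\delta)}(\mathcal{H}^K_\varepsilon)>\xi$. In particular, for any $w^*$ compact, non-empty subset $K$ of $X^*$, $$Sz(K)=\sup_{\varepsilon>0}o_w(\mathcal{H}^K_\varepsilon)=\sup_{\varepsilon>\delta>0}o_{(K,\delta)}(\mathcal{H}^K_\varepsilon).$$
   Context: $B_X$ is the closed unit ball of $X$. Orders and indices take values in the ordinals together with the symbol $\infty$, where $\xi<\infty$ for every ordinal $\xi$. For a set $\Lambda$, $\Lambda^{<\mathbb{N}}$ denotes the finite sequences in $\Lambda$, including the empty sequence $\varnothing$; $t^\frown x$ denotes the sequence $t$ followed by $x$; and $x\in t$ means $x$ is a term of the sequence $t$. Szlenk index: for $K\subset X^*$ $w^*$ compact and $\varepsilon>0$, $s_\varepsilon(K)=K\setminus\bigcup\{W\subset X^*: W\ w^*\text{-open},\ \mathrm{diam}(K\cap W)\leqslant\varepsilon\}$ (norm diameter), $s^0_\varepsilon(K)=K$, $s_\varepsilon^{\xi+1}(K)=s_\varepsilon(s_\varepsilon^\xi(K))$, and $s^\xi_\varepsilon(K)=\bigcap_{\zeta<\xi}s^\zeta_\varepsilon(K)$ for limit $\xi$. $Sz_\varepsilon(K)$ is the least ordinal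 $\xi$ with $s^\xi_\varepsilon(K)=\varnothing$ if one exists, and $Sz_\varepsilon(K)=\infty$ otherwise; $Sz(K)=\sup_{\varepsilon>0}Sz_\varepsilon(K)$. Derivations: for $\mathcal{H}\subset\Lambda^{<\mathbb{N}}$ and a non-empty family $D$ of subsets of $\Lambda$, $(\mathcal{H})'_D=\{t\in\mathcal{H}:\forall U\in D\ \exists x\in U\ (t^\frown x\in\mathcal{H})\}$, $(\mathcal{H})^0_D=\mathcal{H}$, $(\mathcal{H})^{\xi+1}_D=((\mathcal{H})^\xi_D)'_D$, and $(\mathcal{H})^\xi_D=\bigcap_{\zeta<\xi}(\mathcal{H})^\zeta_D$ for limit $\xi$. $o_D(\mathcal{H})$ is the least $\xi$ with $(\mathcal{H})^\xi_D=\varnothing$ if one exists, and $\infty$ otherwise. When $\Lambda=X$ and $D$ is a weak neighborhood basis at $0$ in $X$, the derivation does not depend on the choice of basis, and one writes $o_w(\mathcal{H})$ for $o_D(\mathcal{H})$. For $K\subset X^*$ and $\delta>0$, $(K,\delta)$ is the family of all sets $\{x\in X:|x^*(x)|<\delta\ \forall x^*\in F\}$ with $F\subset K$ finite. For $K\subset X^*$ non-empty and $w^*$ compact and $\varepsilon>0$, $\mathcal{H}^K_\varepsilon=\{t\in B_X^{<\mathbb{N}}:\exists x^*\in K\ (x^*(x)\geqslant\varepsilon\ \forall x\in t)\}$, which includes the empty sequence. *)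

theory Defs
  imports "HOL-Analysis.Analysis"
begin

section \<open>Ordinals\<close>

text \<open>
  \<open>'b ordinal\<close> consists of the order types of the well-orders on subsets of \<open>'b\<close>, that is, of the
  ordinals of cardinality at most that of \<open>'b\<close>. No HOL type contains all ordinals; statements about
  all ordinals are made for \<open>'b ordinal\<close> with \<open>'b\<close> a free type variable.
\<close>

quotient_type 'b ordinal = "'b rel" / partial: "\<lambda>r s. (r, s) \<in> ordIso"
proof (rule part_equivpI)
  have "Well_order ({} :: 'b rel)"
    by simp
  then show "\<exists>r :: 'b rel. (r, r) \<in> ordIso"
    using ordIso_reflexive by blast
  show "symp (\<lambda>r s :: 'b rel. (r, s) \<in> ordIso)"
    by (auto intro!: sympI ordIso_symmetric)
  show "transp (\<lambda>r s :: 'b rel. (r, s) \<in> ordIso)"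
    by (auto intro!: transpI intro: ordIso_transitive)
qed

instantiation ordinal :: (type) wellorder
begin

lift_definition less_eq_ordinal :: "'b ordinal \<Rightarrow> 'b ordinal \<Rightarrow> bool" is "\<lambda>r s. (r, s) \<in> ordLeq"
  by (meson ordIso_ordLeq_trans ordIso_symmetric ordLeq_ordIso_trans)

lift_definition less_ordinal :: "'b ordinal \<Rightarrow> 'b ordinal \<Rightarrow> bool" is "\<lambda>r s. (r, s) \<in> ordLess"
  by (meson ordIso_ordLess_trans ordIso_symmetric ordLess_ordIso_trans)

instance
proof
  fix x y z :: "'b ordinal"
  have wo: "Well_order r" if "(r, r) \<in> ordIso" for r :: "'b rel"
    using that by (simp add: ordIso_def)
  show "(x < y) = (x \<le> y \<and> \<not> y \<le> x)"
    by transfer (meson not_ordLeq_iff_ordLess ordLess_imp_ordLeq wo)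
  show "x \<le> x"
    by transfer (simp add: ordIso_imp_ordLeq)
  show "x \<le> y \<Longrightarrow> y \<le> z \<Longrightarrow> x \<le> z"
    by transfer (meson ordLeq_transitive)
  show "x \<le> y \<Longrightarrow> y \<le> x \<Longrightarrow> x = y"
    by transfer (simp add: ordIso_iff_ordLeq)
  show "x \<le> y \<or> y \<le> x"
    by transfer (meson ordLeq_total wo)
next
  fix P :: "'b ordinal \<Rightarrow> bool" and a :: "'b ordinal"
  assume step: "\<And>x. (\<And>y. y < x \<Longrightarrow> P y) \<Longrightarrow> P x"
  have "(r, r) \<in> ordIso \<longrightarrow> P (abs_ordinal r)" for r :: "'b rel"
  proof (induction r rule: wf_induct_rule[OF wf_ordLess])
    case IH: (1 r)
    show ?case
    proof (rule impI, rule step)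
      fix y assume r: "(r, r) \<in> ordIso" and y: "y < abs_ordinal r"
      then show "P y"
      proof (induction y rule: ordinal.abs_induct)
        case (1 s)
        then show "P (abs_ordinal s)"
          using IH r by (simp add: less_ordinal.abs_eq)
      qed
    qed
  qed
  then show "P a"
    by (induction a rule: ordinal.abs_induct) blast
qed

end

datatype 'o extended_ord = Ord 'o | OrdInf

instantiation extended_ord :: (ord) ord
begin

fun less_eq_extended_ord :: "'a extended_ord \<Rightarrow> 'a extended_ord \<Rightarrow> bool" where
  "x \<le> OrdInf \<longleftrightarrow> True"
| "Ord a \<le> Ord b \<longleftrightarrow> a \<le> b"
| "OrdInf \<le> Ord b \<longleftrightarrow> False"

definition less_extended_ord :: "'a extended_ord \<Rightarrow> 'a extended_ord \<Rightarrow> bool" where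
  "x < y \<longleftrightarrow> x \<le> y \<and> \<not> y \<le> x" for x y :: "'a extended_ord"

instance ..

end

instantiation extended_ord :: (wellorder) complete_linorder
begin

definition "bot_extended_ord = Ord (LEAST a :: 'a. True)"

definition "top_extended_ord = (OrdInf :: 'a extended_ord)"

definition "inf_extended_ord = (min :: 'a extended_ord \<Rightarrow> _)"

definition "sup_extended_ord = (max :: 'a extended_ord \<Rightarrow> _)"

definition Inf_extended_ord :: "'a extended_ord set \<Rightarrow> 'a extended_ord" where
  "Inf A = (if \<exists>a. Ord a \<in> A then Ord (LEAST a. Ord a \<in> A) else OrdInf)"

definition Sup_extended_ord :: "'a extended_ord set \<Rightarrow> 'a extended_ord" where
  "Sup A = Inf {y. \<forall>x\<in>A. x \<le> y}" for A :: "'a extended_ord set"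

instance
proof
  fix x y z :: "'a extended_ord" and A :: "'a extended_ord set"
  show "(x < y) = (x \<le> y \<and> \<not> y \<le> x)"
    by (rule less_extended_ord_def)
  show le_refl: "x \<le> x" for x :: "'a extended_ord"
    by (cases x) auto
  show "x \<le> y \<Longrightarrow> y \<le> z \<Longrightarrow> x \<le> z"
    by (cases x; cases y; cases z) auto
  show "x \<le> y \<Longrightarrow> y \<le> x \<Longrightarrow> x = y"
    by (cases x; cases y) auto
  show total: "x \<le> y \<or> y \<le> x" for x y :: "'a extended_ord"
    by (cases x; cases y) auto
  show "inf x y \<le> x" "inf x y \<le> y"
    using total[of x y] by (auto simp: inf_extended_ord_def min_def le_refl)
  show "x \<le> y \<Longrightarrow> x \<le> z \<Longrightarrow> x \<le> inf y z"
    by (auto simp: inf_extended_ord_def min_def)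
  show "x \<le> sup x y" "y \<le> sup x y"
    using total[of x y] by (auto simp: sup_extended_ord_def max_def le_refl)
  show "y \<le> x \<Longrightarrow> z \<le> x \<Longrightarrow> sup y z \<le> x"
    by (auto simp: sup_extended_ord_def max_def)
  have Inf_lower: "Inf B \<le> u" if "u \<in> B" for u :: "'a extended_ord" and B
    using that Least_le[of "\<lambda>a. Ord a \<in> B"] by (cases u) (auto simp: Inf_extended_ord_def)
  have Inf_greatest: "u \<le> Inf B" if "\<And>v. v \<in> B \<Longrightarrow> u \<le> v" for u :: "'a extended_ord" and B
  proof (cases "\<exists>a. Ord a \<in> B")
    case True
    then have "Ord (LEAST a. Ord a \<in> B) \<in> B"
      by (rule LeastI_ex)
    then show ?thesis
      using True that by (simp add: Inf_extended_ord_def)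
  next
    case False
    then show ?thesis
      by (simp add: Inf_extended_ord_def)
  qed
  show "x \<in> A \<Longrightarrow> Inf A \<le> x"
    by (rule Inf_lower)
  show "(\<And>x. x \<in> A \<Longrightarrow> z \<le> x) \<Longrightarrow> z \<le> Inf A"
    by (rule Inf_greatest)
  show "x \<in> A \<Longrightarrow> x \<le> Sup A"
    unfolding Sup_extended_ord_def by (rule Inf_greatest) auto
  show "(\<And>x. x \<in> A \<Longrightarrow> x \<le> z) \<Longrightarrow> Sup A \<le> z"
    unfolding Sup_extended_ord_def by (rule Inf_lower) auto
  show "Inf ({} :: 'a extended_ord set) = top"
    by (simp add: Inf_extended_ord_def top_extended_ord_def)
  show "Sup ({} :: 'a extended_ord set) = bot"
  proof -
    have "(LEAST a :: 'a. Ord a \<in> UNIV) = (LEAST a. True)"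
      by simp
    then show ?thesis
      by (simp add: Sup_extended_ord_def Inf_extended_ord_def bot_extended_ord_def)
  qed
qed

end


section \<open>Transfinite iteration of a derivation\<close>

text \<open>\<open>is_succ \<zeta> \<xi>\<close>: \<open>\<xi>\<close> is the successor \<open>\<zeta> + 1\<close> of \<open>\<zeta>\<close>.\<close>

definition is_succ :: "'o::wellorder \<Rightarrow> 'o \<Rightarrow> bool" where
  "is_succ \<zeta> \<xi> \<longleftrightarrow> {..<\<xi>} = {..\<zeta>}"

lemma is_succ_less: "is_succ \<zeta> \<xi> \<Longrightarrow> \<zeta> < \<xi>"
  unfolding is_succ_def by blast

lemma is_succ_unique: "is_succ \<zeta> \<xi> \<Longrightarrow> is_succ \<eta> \<xi> \<Longrightarrow> \<zeta> = \<eta>"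
  unfolding is_succ_def by simp

lemma is_succ_the: "is_succ \<zeta> \<xi> \<Longrightarrow> (THE \<zeta>. is_succ \<zeta> \<xi>) = \<zeta>"
  by (blast intro: the_equality is_succ_unique)

function transfinite_iter :: "('s set \<Rightarrow> 's set) \<Rightarrow> 's set \<Rightarrow> 'o::wellorder \<Rightarrow> 's set" where
  "transfinite_iter d A \<xi> =
    (if {..<\<xi>} = {} then A
     else if \<exists>\<zeta>. is_succ \<zeta> \<xi> then d (transfinite_iter d A (THE \<zeta>. is_succ \<zeta> \<xi>))
     else (\<Inter>\<zeta>\<in>{..<\<xi>}. transfinite_iter d A \<zeta>))"
  by pat_completeness auto
termination
proof (relation "inv_image {(x, y). x < y} (\<lambda>(d, A, \<xi>). \<xi>)", goal_cases)
  case 1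
  show ?case
    by (rule wf_inv_image) (rule wf)
next
  case (2 d A \<xi>)
  then show ?case
    using is_succ_less is_succ_the by fastforce
next
  case (3 d A \<xi> \<zeta>)
  then show ?case
    by simp
qed

declare transfinite_iter.simps [simp del]

lemma transfinite_iter_zero:
  "{..<\<xi>} = {} \<Longrightarrow> transfinite_iter d A \<xi> = A"
  by (subst transfinite_iter.simps) simp

lemma transfinite_iter_succ:
  assumes "is_succ \<zeta> \<xi>"
  shows "transfinite_iter d A \<xi> = d (transfinite_iter d A \<zeta>)"
  using assms is_succ_less[OF assms] is_succ_the[OF assms]
  by (subst transfinite_iter.simps) auto

lemma transfinite_iter_limit:
  assumes "{..<\<xi>} \<noteq> {}" "\<nexists>\<zeta>. is_succ \<zeta> \<xi>"
  shows "transfinite_iter d A \<xi> = (\<Inter>\<zeta>\<in>{..<\<xi>}. transfinite_iter d A \<zeta>)"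
  using assms by (subst transfinite_iter.simps) auto

text \<open>
  The least ordinal at which a transfinite sequence of sets is empty, and \<open>\<infinity>\<close> if there is none. For
  \<open>'o = 'b ordinal\<close> the ordinals in question are those of cardinality at most that of \<open>'b\<close>. The
  iterates of a derivation \<open>d\<close> (with \<open>d B \<subseteq> B\<close>) starting at \<open>A\<close> decrease strictly until they
  stabilise, hence they stabilise at an ordinal of cardinality at most that of \<open>A\<close>. So the value is
  the one computed in the class of all ordinals as soon as \<open>'b\<close> has at least the cardinality of \<open>A\<close>
  (and countable suprema of such values are the true ones if \<open>'b\<close> is also infinite). For arbitrary
  \<open>'b\<close>, \<open>vanishing_index S > Ord \<xi>\<close> always means that \<open>S \<zeta>\<close> is non-empty for all \<open>\<zeta> \<le> \<xi>\<close>.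
\<close>

definition vanishing_index :: "('o::wellorder \<Rightarrow> 's set) \<Rightarrow> 'o extended_ord" where
  "vanishing_index S = (if \<exists>\<xi>. S \<xi> = {} then Ord (LEAST \<xi>. S \<xi> = {}) else OrdInf)"


section \<open>Weak and weak-star topologies\<close>

text \<open>
  The dual of \<open>X\<close> is \<open>'a \<Rightarrow>\<^sub>L real\<close>. For functionals the strong operator topology, the topology of
  pointwise convergence, is the weak-star topology.
\<close>

abbreviation weak_star_topology :: "('a::real_normed_vector \<Rightarrow>\<^sub>L real) topology" where
  "weak_star_topology \<equiv> strong_operator_topology"

text \<open>
  Here \<open>euclidean\<close> is the product topology on functions from the dual to the reals, so this is the
  coarsest topology on \<open>X\<close> making all bounded functionals continuous.
\<close>

definition weak_topology :: "'a::real_normed_vector topology" where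
  "weak_topology = pullback_topology UNIV (\<lambda>x (f :: 'a \<Rightarrow>\<^sub>L real). blinfun_apply f x) euclidean"


section \<open>The Szlenk index\<close>

text \<open>
  The library's \<open>diameter\<close> is real-valued and is only meaningful for bounded sets; an unbounded set
  has infinite diameter.
\<close>

definition szlenk_deriv ::
    "real \<Rightarrow> ('a::real_normed_vector \<Rightarrow>\<^sub>L real) set \<Rightarrow> ('a \<Rightarrow>\<^sub>L real) set" where
  "szlenk_deriv \<epsilon> K =
    K - \<Union>{W. openin weak_star_topology W \<and> bounded (K \<inter> W) \<and> diameter (K \<inter> W) \<le> \<epsilon>}"

definition Sz_eps ::
    "real \<Rightarrow> ('a::real_normed_vector \<Rightarrow>\<^sub>L real) set \<Rightarrow> 'o::wellorder extended_ord" where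
  "Sz_eps \<epsilon> K = vanishing_index (transfinite_iter (szlenk_deriv \<epsilon>) K)"

definition Sz :: "('a::real_normed_vector \<Rightarrow>\<^sub>L real) set \<Rightarrow> 'o::wellorder extended_ord" where
  "Sz K = (SUP \<epsilon>\<in>{0<..}. Sz_eps \<epsilon> K)"


section \<open>Derivations of sets of finite sequences\<close>

definition seq_deriv :: "'l set set \<Rightarrow> 'l list set \<Rightarrow> 'l list set" where
  "seq_deriv D H = {t \<in> H. \<forall>U\<in>D. \<exists>x\<in>U. t @ [x] \<in> H}"

definition seq_order :: "'l set set \<Rightarrow> 'l list set \<Rightarrow> 'o::wellorder extended_ord" where
  "seq_order D H = vanishing_index (transfinite_iter (seq_deriv D) H)"

definition weak_nhds_zero :: "'a::real_normed_vector set set" where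
  "weak_nhds_zero = {U. openin weak_topology U \<and> 0 \<in> U}"

definition weak_order :: "'a::real_normed_vector list set \<Rightarrow> 'o::wellorder extended_ord" where
  "weak_order H = seq_order weak_nhds_zero H"

text \<open>
  The order does not depend on the choice of the weak neighbourhood basis at \<open>0\<close>, whose members
  need not be open.
\<close>

definition weak_nhd_basis_zero :: "'a::real_normed_vector set set \<Rightarrow> bool" where
  "weak_nhd_basis_zero D \<longleftrightarrow>
    (\<forall>U\<in>D. \<exists>V\<in>weak_nhds_zero. V \<subseteq> U) \<and> (\<forall>V\<in>weak_nhds_zero. \<exists>U\<in>D. U \<subseteq> V)"

lemma weak_nhd_basis_zero_weak_nhds_zero: "weak_nhd_basis_zero weak_nhds_zero"
  unfolding weak_nhd_basis_zero_def by blast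

lemma seq_order_weak_nhd_basis_zero:
  assumes "weak_nhd_basis_zero D"
  shows "seq_order D H = weak_order H"
proof -
  have "(\<forall>U\<in>D. \<exists>x\<in>U. t @ [x] \<in> G) \<longleftrightarrow> (\<forall>V\<in>weak_nhds_zero. \<exists>x\<in>V. t @ [x] \<in> G)" for t G
    using assms unfolding weak_nhd_basis_zero_def by (metis subsetD)
  then have "seq_deriv D G = seq_deriv weak_nhds_zero G" for G
    by (simp add: seq_deriv_def)
  then have "seq_deriv D = seq_deriv weak_nhds_zero"
    by blast
  then show ?thesis
    by (simp add: seq_order_def weak_order_def)
qed

text \<open>The family \<open>(K, \<delta>)\<close>.\<close>

definition nhds_of :: "('a::real_normed_vector \<Rightarrow>\<^sub>L real) set \<Rightarrow> real \<Rightarrow> 'a set set" where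
  "nhds_of K \<delta> = {{x. \<forall>f\<in>F. \<bar>blinfun_apply f x\<bar> < \<delta>} | F. finite F \<and> F \<subseteq> K}"

text \<open>The set \<open>\<H>\<^sup>K\<^sub>\<epsilon>\<close>.\<close>

definition H_tree :: "('a::real_normed_vector \<Rightarrow>\<^sub>L real) set \<Rightarrow> real \<Rightarrow> 'a list set" where
  "H_tree K \<epsilon> = {t. set t \<subseteq> cball 0 1 \<and> (\<exists>f\<in>K. \<forall>x\<in>set t. blinfun_apply f x \<ge> \<epsilon>)}"

end

theory Submission
  imports Defs
begin

text \<open>
  (i) to (ii): every weak-star neighbourhood of a point \<open>f\<close> of \<open>s\<^sub>\<epsilon>(S)\<close> contains some \<open>g \<in> S\<close> with
  \<open>\<parallel>g - f\<parallel> > \<epsilon>/2\<close>, so \<open>g - f\<close> is large at some \<open>x\<close> in the unit ball. Let \<open>U\<close> be a weak neighbourhood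
  of \<open>0\<close>. The unit ball is weakly totally bounded, so \<open>g\<close> may be chosen close to \<open>f\<close> on a finite set
  \<open>A\<close> of the ball such that some \<open>a \<in> A\<close> makes \<open>y = (x - a)/2\<close> lie in \<open>U\<close> with \<open>f y\<close> small; then \<open>g y\<close> is
  large, and \<open>y\<close> extends the sequence one step.

  (ii) to (iii): the sets in \<open>(K, \<delta>)\<close> are weak neighbourhoods of \<open>0\<close>.

  (iii) to (i): for \<open>\<rho> < \<epsilon> - \<delta>\<close>, each sequence \<open>t\<close> in the \<open>\<xi>\<close>-th derived set is witnessed by a functional
  in \<open>s\<^sub>\<rho>\<^sup>\<xi>(K)\<close>. Otherwise the functionals in \<open>s\<^sub>\<rho>\<^sup>\<zeta>(K)\<close>, \<open>\<xi> = \<zeta> + 1\<close>, witnessing \<open>t\<close> are covered by finitely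
  many pieces of diameter at most \<open>\<rho>\<close>. Some extension \<open>y\<close> of \<open>t\<close> has values below \<open>\<delta>\<close> under one functional
  from each piece, whereas the functional witnessing \<open>t\<close> followed by \<open>y\<close> is at least \<open>\<epsilon>\<close> at \<open>y\<close>.
\<close>

section \<open>Transfinite iterates and extended ordinals\<close>

lemma wellorder_zero_succ_limit_induct [case_names zero succ limit]:
  fixes \<xi> :: "'o::wellorder"
  assumes "\<And>\<xi>. {..<\<xi>} = {} \<Longrightarrow> P \<xi>"
    and "\<And>\<zeta> \<xi>. is_succ \<zeta> \<xi> \<Longrightarrow> P \<zeta> \<Longrightarrow> P \<xi>"
    and "\<And>\<xi>. {..<\<xi>} \<noteq> {} \<Longrightarrow> \<nexists>\<zeta>. is_succ \<zeta> \<xi> \<Longrightarrow> (\<And>\<zeta>. \<zeta> < \<xi> \<Longrightarrow> P \<zeta>) \<Longrightarrow> P \<xi>"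
  shows "P \<xi>"
proof (induction \<xi> rule: less_induct)
  case (less \<xi>)
  then show ?case
    using assms is_succ_less by metis
qed

lemma transfinite_iter_antimono:
  fixes \<zeta> \<xi> :: "'o::wellorder"
  assumes d: "\<And>B. d B \<subseteq> B" and "\<zeta> \<le> \<xi>"
  shows "transfinite_iter d A \<xi> \<subseteq> transfinite_iter d A \<zeta>"
  using \<open>\<zeta> \<le> \<xi>\<close>
proof (induction \<xi> rule: wellorder_zero_succ_limit_induct)
  case (zero \<xi>)
  then have "\<zeta> = \<xi>"
    by (metis empty_iff lessThan_iff order_le_less)
  then show ?case
    by simp
next
  case (succ \<eta> \<xi>)
  show ?case
  proof (cases "\<zeta> = \<xi>")
    case False
    then have "\<zeta> \<in> {..<\<xi>}"
      using succ.prems by simp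
    then have "\<zeta> \<le> \<eta>"
      using succ.hyps unfolding is_succ_def by simp
    then show ?thesis
      unfolding transfinite_iter_succ[OF succ.hyps] using succ.IH d subset_trans by metis
  qed simp
next
  case (limit \<xi>)
  show ?case
  proof (cases "\<zeta> = \<xi>")
    case False
    then show ?thesis
      using limit by (auto simp: transfinite_iter_limit)
  qed simp
qed

lemma transfinite_iter_subset:
  fixes \<xi> :: "'o::wellorder"
  assumes d: "\<And>B. d B \<subseteq> B"
  shows "transfinite_iter d A \<xi> \<subseteq> A"
proof (induction \<xi> rule: wellorder_zero_succ_limit_induct)
  case (succ \<zeta> \<xi>)
  then show ?case
    unfolding transfinite_iter_succ[OF succ.hyps] using d subset_trans by metis
qed (auto simp: transfinite_iter_zero transfinite_iter_limit)

text \<open>At a successor, \<open>d\<close> of the first iterate lies in \<open>e\<close> of the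
  same set, and \<open>mono e\<close> carries this on to \<open>e\<close> of the second
  iterate.\<close>

lemma transfinite_iter_mono:
  fixes \<xi> :: "'o::wellorder"
  assumes "\<And>B. d B \<subseteq> e B" and "mono e"
  shows "transfinite_iter d A \<xi> \<subseteq> transfinite_iter e A \<xi>"
proof (induction \<xi> rule: wellorder_zero_succ_limit_induct)
  case (succ \<zeta> \<xi>)
  then show ?case
    unfolding transfinite_iter_succ[OF succ.hyps] using assms subset_trans monoD by metis
next
  case (limit \<xi>)
  then show ?case
    by (auto simp: transfinite_iter_limit)
qed (simp add: transfinite_iter_zero)

text \<open>\<open>S\<close> is arbitrary, so non-emptiness at \<open>\<xi>\<close> alone would not
  exclude an earlier empty value; hence the quantifier over \<open>\<zeta>\<close>.\<close>

lemma Ord_less_vanishing_index: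
  "Ord \<xi> < vanishing_index S \<longleftrightarrow> (\<forall>\<zeta>\<le>\<xi>. S \<zeta> \<noteq> {})"
proof (cases "\<exists>\<zeta>. S \<zeta> = {}")
  case True
  then have "Ord \<xi> < vanishing_index S \<longleftrightarrow> \<xi> < (LEAST \<zeta>. S \<zeta> = {})"
    by (auto simp: vanishing_index_def less_extended_ord_def)
  also have "\<dots> \<longleftrightarrow> (\<forall>\<zeta>\<le>\<xi>. S \<zeta> \<noteq> {})"
    using True by (metis (mono_tags, lifting) LeastI_ex not_less_Least le_less_trans not_le)
  finally show ?thesis .
next
  case False
  then show ?thesis
    by (auto simp: vanishing_index_def less_extended_ord_def)
qed

text \<open>If \<open>x < y\<close>, then \<open>x\<close> is some \<open>Ord \<xi>\<close>, and
  this \<open>\<xi>\<close> separates the two. Equality of suprema thus reduces to an equivalence at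
  each ordinal.\<close>

lemma extended_ord_eqI:
  fixes x y :: "'o::wellorder extended_ord"
  assumes "\<And>\<xi>. Ord \<xi> < x \<longleftrightarrow> Ord \<xi> < y"
  shows "x = y"
proof (rule linorder_cases[of x y])
  assume "x < y"
  then have "x \<noteq> OrdInf"
    by (auto simp: less_extended_ord_def)
  then show ?thesis
    using assms \<open>x < y\<close> by (cases x) auto
next
  assume "y < x"
  then have "y \<noteq> OrdInf"
    by (auto simp: less_extended_ord_def)
  then show ?thesis
    using assms \<open>y < x\<close> by (cases y) auto
qed

section \<open>Weak-star and weak neighbourhoods\<close>

lemma openin_weak_star_preimage:
  assumes "open V"
  shows "openin weak_star_topology {f :: 'a::real_normed_vector \<Rightarrow>\<^sub>L real. blinfun_apply f x \<in> V}"
  using openin_continuous_map_preimage[OF strong_operator_topology_continuous_evaluation, of V x] assms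
  by (simp add: strong_operator_topology_topspace)

lemma openin_weak_star_INT:
  fixes U :: "'i \<Rightarrow> ('a::real_normed_vector \<Rightarrow>\<^sub>L real) set"
  assumes "finite I" "\<And>i. i \<in> I \<Longrightarrow> openin weak_star_topology (U i)"
  shows "openin weak_star_topology (\<Inter>i\<in>I. U i)"
  using openin_INT[OF assms] by (simp add: strong_operator_topology_topspace)

lemma closedin_weak_star_ge:
  "closedin weak_star_topology {f :: 'a::real_normed_vector \<Rightarrow>\<^sub>L real. \<forall>x\<in>set t. \<epsilon> \<le> blinfun_apply f x}"
proof -
  have "openin weak_star_topology (\<Union>x\<in>set t. {f :: 'a \<Rightarrow>\<^sub>L real. blinfun_apply f x \<in> {..<\<epsilon>}})"
    by (intro openin_Union ballI) (auto intro!: openin_weak_star_preimage simp del: lessThan_iff)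
  moreover have "UNIV - {f :: 'a \<Rightarrow>\<^sub>L real. \<forall>x\<in>set t. \<epsilon> \<le> blinfun_apply f x}
      = (\<Union>x\<in>set t. {f :: 'a \<Rightarrow>\<^sub>L real. blinfun_apply f x \<in> {..<\<epsilon>}})"
    by (auto simp: not_le)
  ultimately show ?thesis
    by (simp add: closedin_def strong_operator_topology_topspace)
qed

lemma nhds_of_subset_weak_nhds_zero:
  assumes "0 < \<delta>"
  shows "nhds_of K \<delta> \<subseteq> weak_nhds_zero"
proof
  fix U
  assume "U \<in> nhds_of K \<delta>"
  then obtain F where F: "finite F" "U = {x. \<forall>f\<in>F. \<bar>blinfun_apply f x\<bar> < \<delta>}"
    by (auto simp: nhds_of_def)
  have "open (\<Inter>f\<in>F. {\<phi> :: ('a \<Rightarrow>\<^sub>L real) \<Rightarrow> real. \<bar>\<phi> f\<bar> < \<delta>})"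
    using F(1) by (intro open_INT ballI open_Collect_less continuous_intros
        continuous_on_product_coordinates) auto
  moreover have "U = (\<lambda>x f. blinfun_apply f x) -` (\<Inter>f\<in>F. {\<phi>. \<bar>\<phi> f\<bar> < \<delta>}) \<inter> UNIV"
    using F by auto
  ultimately have "openin weak_topology U"
    unfolding weak_topology_def openin_pullback_topology by (metis open_openin)
  then show "U \<in> weak_nhds_zero"
    using F assms by (simp add: weak_nhds_zero_def)
qed

text \<open>An open set of the product topology contains a box around the zero function that
  restricts only finitely many coordinates; these form \<open>F\<close>.\<close>

lemma weak_nhds_zero_basic:
  fixes U :: "'a::real_normed_vector set"
  assumes "U \<in> weak_nhds_zero"
  obtains F :: "('a \<Rightarrow>\<^sub>L real) set" and \<delta> where "finite F" "0 < \<delta>" "{x. \<forall>f\<in>F. \<bar>blinfun_apply f x\<bar> < \<delta>} \<subseteq> U"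
proof -
  obtain V where V: "open V" "U = (\<lambda>x (f :: 'a \<Rightarrow>\<^sub>L real). blinfun_apply f x) -` V"
    using assms by (auto simp: weak_nhds_zero_def weak_topology_def openin_pullback_topology)
  have "(\<lambda>f. 0) \<in> V"
    using assms V(2) by (simp add: weak_nhds_zero_def)
  moreover have "openin (product_topology (\<lambda>f. euclidean) UNIV) V"
    using V(1) by (simp only: open_fun_def)
  ultimately have "\<exists>X. (\<lambda>f. 0) \<in> Pi\<^sub>E UNIV X \<and> (\<forall>f. open (X f)) \<and>
      finite {f. X f \<noteq> UNIV} \<and> Pi\<^sub>E UNIV X \<subseteq> V"
    using product_topology_open_contains_basis by fastforce
  then obtain X where X: "(\<lambda>f :: 'a \<Rightarrow>\<^sub>L real. 0 :: real) \<in> Pi\<^sub>E UNIV X" "\<And>f. open (X f)"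
      "finite {f. X f \<noteq> UNIV}" "Pi\<^sub>E UNIV X \<subseteq> V"
    by blast
  have "\<exists>d>0. ball 0 d \<subseteq> X f" for f
    using X(1,2) by (auto simp: open_contains_ball PiE_iff)
  then obtain d where d: "\<And>f. 0 < d f" "\<And>f. ball 0 (d f) \<subseteq> X f"
    by metis
  define F where "F = {f. X f \<noteq> UNIV}"
  \<comment> \<open>The entry \<open>1\<close> keeps the minimum meaningful and positive when
    \<open>F\<close> is empty.\<close>
  define \<delta> where "\<delta> = Min (insert 1 (d ` F))"
  have F: "finite F"
    using X(3) by (simp add: F_def)
  show thesis
  proof
    show "0 < \<delta>"
      using F d(1) by (auto simp: \<delta>_def)
    show "{x. \<forall>f\<in>F. \<bar>blinfun_apply f x\<bar> < \<delta>} \<subseteq> U"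
    proof
      fix x
      assume x: "x \<in> {x. \<forall>f\<in>F. \<bar>blinfun_apply f x\<bar> < \<delta>}"
      have "blinfun_apply f x \<in> X f" for f
      proof (cases "f \<in> F")
        case True
        then have "\<delta> \<le> d f"
          using F by (auto simp: \<delta>_def)
        then have "blinfun_apply f x \<in> ball 0 (d f)"
          using x True by auto
        then show ?thesis
          using d(2) by blast
      qed (simp add: F_def)
      then show "x \<in> U"
        using X(4) V(2) by (auto simp: PiE_iff subset_iff)
    qed
  qed (rule F)
qed

text \<open>Each \<open>f \<in> F\<close> is bounded on the ball, so rounding its values down to
  multiples of \<open>\<delta>\<close> leaves finitely many patterns; \<open>A\<close> takes points
  of the ball realising all of them.\<close>

lemma cball_weakly_totally_bounded:
  fixes F :: "('a::real_normed_vector \<Rightarrow>\<^sub>L real) set"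
  assumes "finite F" "0 < \<delta>"
  obtains A where "finite A" "A \<subseteq> cball 0 1"
    "\<And>x. x \<in> cball 0 1 \<Longrightarrow> \<exists>a\<in>A. \<forall>f\<in>F. \<bar>blinfun_apply f (x - a)\<bar> < \<delta>"
proof -
  \<comment> \<open>Restricting the pattern to \<open>F\<close> makes it an element of a finite
    extensional product.\<close>
  define g where "g x = (\<lambda>f\<in>F. \<lfloor>blinfun_apply f x / \<delta>\<rfloor>)" for x :: 'a
  have "g ` cball 0 1 \<subseteq> Pi\<^sub>E F (\<lambda>f. {\<lfloor>- norm f / \<delta>\<rfloor>..\<lfloor>norm f / \<delta>\<rfloor>})"
  proof (clarsimp simp: g_def)
    fix x :: 'a and f
    assume x: "norm x \<le> 1"
    have "\<bar>blinfun_apply f x\<bar> \<le> norm f"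
      using norm_blinfun[of f x] mult_left_mono[OF x norm_ge_zero[of f]] by simp
    then show "\<lfloor>- (norm f / \<delta>)\<rfloor> \<le> \<lfloor>blinfun_apply f x / \<delta>\<rfloor> \<and>
        \<lfloor>blinfun_apply f x / \<delta>\<rfloor> \<le> \<lfloor>norm f / \<delta>\<rfloor>"
      using assms(2) by (intro conjI floor_mono) (auto simp: field_simps abs_le_iff)
  qed
  then have "finite (g ` cball 0 1)"
    using assms(1) by (meson finite_PiE finite_atLeastAtMost_int finite_subset)
  then obtain A where A: "finite A" "A \<subseteq> cball 0 1" "g ` cball 0 1 = g ` A"
    using finite_subset_image[of "g ` cball 0 1" g "cball 0 1"] by auto
  show thesis
  proof
    fix x :: 'a
    assume "x \<in> cball 0 1"
    then obtain a where a: "a \<in> A" "g x = g a"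
      using A(3) by (metis imageE imageI)
    have "\<bar>blinfun_apply f (x - a)\<bar> < \<delta>" if "f \<in> F" for f
    proof -
      have "\<lfloor>blinfun_apply f x / \<delta>\<rfloor> = \<lfloor>blinfun_apply f a / \<delta>\<rfloor>"
        using fun_cong[OF a(2), of f] that by (simp add: g_def)
      then have "\<bar>blinfun_apply f x / \<delta> - blinfun_apply f a / \<delta>\<bar> < 1"
        by linarith
      then show ?thesis
        using assms(2) by (simp add: blinfun.diff_right flip: diff_divide_distrib)
    qed
    then show "\<exists>a\<in>A. \<forall>f\<in>F. \<bar>blinfun_apply f (x - a)\<bar> < \<delta>"
      using a(1) by blast
  qed (use A in auto)
qed

section \<open>From the Szlenk derivation to weakly small extensions\<close>

lemma szlenk_deriv_subset: "szlenk_deriv \<epsilon> K \<subseteq> K"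
  by (auto simp: szlenk_deriv_def)

lemma seq_deriv_subset: "seq_deriv D H \<subseteq> H"
  by (auto simp: seq_deriv_def)

lemma seq_derivD: "t \<in> seq_deriv D H \<Longrightarrow> U \<in> D \<Longrightarrow> \<exists>x\<in>U. t @ [x] \<in> H"
  by (simp add: seq_deriv_def)

text \<open>If all of \<open>K \<inter> W\<close> were within \<open>\<epsilon> / 2\<close> of
  \<open>f\<close>, the triangle inequality through \<open>f\<close> would bound its diameter by
  \<open>\<epsilon>\<close>, and \<open>W\<close> would be among the sets removed.\<close>

lemma szlenk_deriv_far_point:
  assumes "f \<in> szlenk_deriv \<epsilon> K" "openin weak_star_topology W" "f \<in> W" "0 < \<epsilon>"
  obtains g where "g \<in> K" "g \<in> W" "\<epsilon> / 2 < norm (g - f)"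
proof -
  have "\<exists>g\<in>K \<inter> W. \<epsilon> / 2 < norm (g - f)"
  proof (rule ccontr)
    assume "\<not> ?thesis"
    then have near: "norm (g - f) \<le> \<epsilon> / 2" if "g \<in> K \<inter> W" for g
      using that by force
    have "dist g h \<le> \<epsilon>" if "g \<in> K \<inter> W" "h \<in> K \<inter> W" for g h
      using near[OF that(1)] near[OF that(2)] dist_triangle2[of g h f]
      by (simp add: dist_norm)
    then have "diameter (K \<inter> W) \<le> \<epsilon>"
      using assms(4) by (intro diameter_le) (auto simp: dist_norm)
    moreover have "bounded (K \<inter> W)"
      using near unfolding bounded_def by (metis dist_norm dist_commute)
    ultimately show False
      using assms(1-3) by (auto simp: szlenk_deriv_def)
  qed
  then show thesis
    using that by blast
qed

lemma blinfun_norming_vector: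
  fixes f :: "'a::real_normed_vector \<Rightarrow>\<^sub>L real"
  assumes "c < norm f" "0 \<le> c"
  obtains x where "x \<in> cball 0 1" "c < blinfun_apply f x"
proof -
  have "\<not> (\<forall>x. norm (blinfun_apply f x) \<le> c * norm x)"
    using norm_blinfun_bound[OF assms(2), of f] assms(1) by auto
  then obtain x where x: "c * norm x < \<bar>blinfun_apply f x\<bar>"
    by (auto simp: not_le)
  then have "x \<noteq> 0"
    by auto
  \<comment> \<open>The sign makes the value at \<open>y\<close> positive, and the division
    normalises \<open>x\<close>.\<close>
  define y where "y = (sgn (blinfun_apply f x) / norm x) *\<^sub>R x"
  have "blinfun_apply f y = \<bar>blinfun_apply f x\<bar> / norm x"
    by (simp add: y_def blinfun.scaleR_right sgn_if)
  moreover have "norm y \<le> 1"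
    using \<open>x \<noteq> 0\<close> by (simp add: y_def sgn_if)
  ultimately show thesis
    using that[of y] x \<open>x \<noteq> 0\<close> by (simp add: pos_less_divide_eq)
qed

lemma szlenk_deriv_weak_extension:
  fixes f :: "'a::real_normed_vector \<Rightarrow>\<^sub>L real"
  assumes f: "f \<in> szlenk_deriv \<epsilon> K" and \<epsilon>: "0 < \<epsilon>" and U: "U \<in> weak_nhds_zero"
    and t: "\<And>x. x \<in> set t \<Longrightarrow> \<epsilon> / 8 < blinfun_apply f x"
  obtains g y where "g \<in> K" "y \<in> U" "y \<in> cball 0 1"
    "\<And>x. x \<in> set (t @ [y]) \<Longrightarrow> \<epsilon> / 8 < blinfun_apply g x"
proof -
  obtain F :: "('a \<Rightarrow>\<^sub>L real) set" and \<delta> where F: "finite F" "0 < \<delta>" "{x. \<forall>f\<in>F. \<bar>blinfun_apply f x\<bar> < \<delta>} \<subseteq> U"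
    using weak_nhds_zero_basic[OF U] .
  define \<eta> where "\<eta> = min \<delta> (\<epsilon> / 16)"
  have \<eta>: "0 < \<eta>" "\<eta> \<le> \<delta>" "\<eta> \<le> \<epsilon> / 16"
    using F \<epsilon> by (auto simp: \<eta>_def)
  \<comment> \<open>\<open>f\<close> joins \<open>F\<close> so that \<open>f (x - a)\<close> is
    small as well. \<open>A\<close> is fixed before \<open>g\<close> and \<open>x\<close> are found,
    so \<open>W\<close> can prescribe the values of \<open>g\<close> on all of
    \<open>A\<close>.\<close>
  obtain A where A: "finite A" "A \<subseteq> cball 0 1"
      "\<And>x. x \<in> cball 0 1 \<Longrightarrow> \<exists>a\<in>A. \<forall>h\<in>insert f F. \<bar>blinfun_apply h (x - a)\<bar> < \<eta>"
    using cball_weakly_totally_bounded[of "insert f F" \<eta>] F \<eta> by blast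
  define W where "W = (\<Inter>x\<in>set t. {g. blinfun_apply g x \<in> {\<epsilon> / 8<..}})
    \<inter> (\<Inter>a\<in>A. {g. blinfun_apply g a \<in> ball (blinfun_apply f a) (\<epsilon> / 16)})"
  have "openin weak_star_topology W"
    unfolding W_def using A(1)
    by (intro openin_Int openin_weak_star_INT openin_weak_star_preimage) auto
  moreover have "f \<in> W"
    using t \<epsilon> by (auto simp: W_def)
  ultimately obtain g where g: "g \<in> K" "g \<in> W" "\<epsilon> / 2 < norm (g - f)"
    using szlenk_deriv_far_point[OF f _ _ \<epsilon>] by metis
  then obtain x where x: "x \<in> cball 0 1" "\<epsilon> / 2 < blinfun_apply (g - f) x"
    using blinfun_norming_vector[of "\<epsilon> / 2" "g - f"] \<epsilon> by auto
  obtain a where a: "a \<in> A" "\<And>h. h \<in> insert f F \<Longrightarrow> \<bar>blinfun_apply h (x - a)\<bar> < \<eta>"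
    using A(3)[OF x(1)] by blast
  \<comment> \<open>The difference of two points of the ball has norm at most 2; halving brings it
    back into the ball.\<close>
  define y where "y = (1 / 2) *\<^sub>R (x - a)"
  show thesis
  proof
    have "norm (x - a) \<le> 2"
      using norm_triangle_ineq4[of x a] x(1) a(1) A(2) by fastforce
    then show "y \<in> cball 0 1"
      by (simp add: y_def)
    have "\<bar>blinfun_apply h y\<bar> < \<delta>" if "h \<in> F" for h
      using a(2)[of h] that \<eta> by (simp add: y_def blinfun.scaleR_right)
    then show "y \<in> U"
      using F(3) by blast
    have "\<bar>blinfun_apply (g - f) a\<bar> < \<epsilon> / 16"
      using g(2) a(1) by (auto simp: W_def blinfun.diff_left dist_real_def abs_minus_commute)
    moreover have "\<bar>blinfun_apply f x - blinfun_apply f a\<bar> < \<epsilon> / 16"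
      using a(2)[of f] \<eta> by (simp add: blinfun.diff_right)
    \<comment> \<open>\<open>g (x - a)\<close> is the sum of \<open>(g - f) x\<close>,
      \<open>- (g - f) a\<close> and \<open>f x - f a\<close>, hence exceeds
      \<open>\<epsilon> / 2 - 2 * (\<epsilon> / 16)\<close>. The halving in \<open>y\<close> turns
      \<open>\<epsilon> / 4\<close> into the bound \<open>\<epsilon> / 8\<close>.\<close>
    ultimately have "\<epsilon> / 4 < blinfun_apply g (x - a)"
      using x(2) \<epsilon> unfolding blinfun.diff_left blinfun.diff_right by linarith
    then have "\<epsilon> / 8 < blinfun_apply g y"
      by (simp add: y_def blinfun.scaleR_right)
    then show "\<epsilon> / 8 < blinfun_apply g z" if "z \<in> set (t @ [y])" for z
      using that g(2) by (auto simp: W_def)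
  qed (rule g(1))
qed

text \<open>Asking for a strict inequality makes the condition on \<open>t\<close> weak-star open in \<open>f\<close>, so that it
  survives the passage from \<open>f\<close> to the nearby functionals at a successor step.\<close>

lemma szlenk_iter_imp_weak_iter:
  fixes K :: "('a::real_normed_vector \<Rightarrow>\<^sub>L real) set" and \<xi> :: "'o::wellorder"
  assumes \<epsilon>: "0 < \<epsilon>"
    and "f \<in> transfinite_iter (szlenk_deriv \<epsilon>) K \<xi>" "set t \<subseteq> cball 0 1"
    and "\<And>x. x \<in> set t \<Longrightarrow> \<epsilon> / 8 < blinfun_apply f x"
  shows "t \<in> transfinite_iter (seq_deriv weak_nhds_zero) (H_tree K (\<epsilon> / 8)) \<xi>"
  using assms(2-)
proof (induction \<xi> arbitrary: f t rule: wellorder_zero_succ_limit_induct)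
  case (zero \<xi>)
  then show ?case
    by (force simp: transfinite_iter_zero H_tree_def)
next
  case (succ \<zeta> \<xi>)
  have f: "f \<in> szlenk_deriv \<epsilon> (transfinite_iter (szlenk_deriv \<epsilon>) K \<zeta>)"
    using succ by (simp add: transfinite_iter_succ)
  have "t \<in> transfinite_iter (seq_deriv weak_nhds_zero) (H_tree K (\<epsilon> / 8)) \<zeta>"
    using f szlenk_deriv_subset succ by blast
  moreover have "\<exists>y\<in>U. t @ [y] \<in> transfinite_iter (seq_deriv weak_nhds_zero) (H_tree K (\<epsilon> / 8)) \<zeta>"
    if U: "U \<in> weak_nhds_zero" for U
  proof -
    obtain g y where "g \<in> transfinite_iter (szlenk_deriv \<epsilon>) K \<zeta>" "y \<in> U" "y \<in> cball 0 1"
      "\<And>x. x \<in> set (t @ [y]) \<Longrightarrow> \<epsilon> / 8 < blinfun_apply g x"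
      using szlenk_deriv_weak_extension[OF f \<epsilon> U succ.prems(3)] by blast
    then show ?thesis
      using succ.IH[of g "t @ [y]"] succ.prems(2) by auto
  qed
  ultimately show ?case
    unfolding transfinite_iter_succ[OF succ.hyps] by (subst seq_deriv_def) blast
next
  case (limit \<xi>)
  have "f \<in> transfinite_iter (szlenk_deriv \<epsilon>) K \<zeta>" if "\<zeta> < \<xi>" for \<zeta>
    using limit.prems(1) that by (simp add: transfinite_iter_limit[OF limit.hyps])
  then show ?case
    using limit.IH limit.prems(2,3) unfolding transfinite_iter_limit[OF limit.hyps] by blast
qed

section \<open>Compactness and the return to the Szlenk derivation\<close>

text \<open>Each derivation removes a union of weak-star open sets, and limits intersect. The form
  \<open>K \<inter> C\<close> lets compactness of \<open>K\<close> pass to the iterates without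
  appeal to the Hausdorff property.\<close>

lemma szlenk_iter_closed:
  fixes K :: "('a::real_normed_vector \<Rightarrow>\<^sub>L real) set" and \<xi> :: "'o::wellorder"
  shows "\<exists>C. closedin weak_star_topology C \<and> transfinite_iter (szlenk_deriv \<epsilon>) K \<xi> = K \<inter> C"
proof (induction \<xi> rule: wellorder_zero_succ_limit_induct)
  case (zero \<xi>)
  then show ?case
    by (metis Int_absorb2 closedin_topspace strong_operator_topology_topspace subset_UNIV
        transfinite_iter_zero)
next
  case (succ \<zeta> \<xi>)
  define S where "S = transfinite_iter (szlenk_deriv \<epsilon>) K \<zeta>"
  obtain C where C: "closedin weak_star_topology C" "S = K \<inter> C"
    using succ.IH by (auto simp: S_def)
  define O' where
    "O' = \<Union>{W. openin weak_star_topology W \<and> bounded (S \<inter> W) \<and> diameter (S \<inter> W) \<le> \<epsilon>}"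
  have "openin weak_star_topology O'"
    unfolding O'_def by (rule openin_Union) auto
  then have "closedin weak_star_topology (C - O')"
    by (rule closedin_diff[OF C(1)])
  moreover have "transfinite_iter (szlenk_deriv \<epsilon>) K \<xi> = K \<inter> (C - O')"
    using C(2) by (auto simp: transfinite_iter_succ[OF succ.hyps] szlenk_deriv_def O'_def S_def)
  ultimately show ?case
    by blast
next
  case (limit \<xi>)
  then obtain C where C: "\<And>\<zeta>. \<zeta> < \<xi> \<Longrightarrow> closedin weak_star_topology (C \<zeta>) \<and>
      transfinite_iter (szlenk_deriv \<epsilon>) K \<zeta> = K \<inter> C \<zeta>"
    by metis
  have "closedin weak_star_topology (\<Inter>\<zeta>\<in>{..<\<xi>}. C \<zeta>)"
    using C limit.hyps(1) by (intro closedin_INT) auto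
  moreover have "transfinite_iter (szlenk_deriv \<epsilon>) K \<xi> = K \<inter> (\<Inter>\<zeta>\<in>{..<\<xi>}. C \<zeta>)"
    using C limit.hyps by (auto simp: transfinite_iter_limit)
  ultimately show ?case
    by blast
qed

lemma compactin_szlenk_iter_ge:
  fixes K :: "('a::real_normed_vector \<Rightarrow>\<^sub>L real) set" and \<xi> :: "'o::wellorder"
  assumes "compactin weak_star_topology K"
  shows "compactin weak_star_topology
    (transfinite_iter (szlenk_deriv \<rho>) K \<xi> \<inter> {f. \<forall>x\<in>set t. \<epsilon> \<le> blinfun_apply f x})"
proof -
  obtain C where C: "closedin weak_star_topology C" "transfinite_iter (szlenk_deriv \<rho>) K \<xi> = K \<inter> C"
    using szlenk_iter_closed by blast
  have "closedin weak_star_topology (C \<inter> {f. \<forall>x\<in>set t. \<epsilon> \<le> blinfun_apply f x})"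
    using C(1) closedin_weak_star_ge by (rule closedin_Int)
  then show ?thesis
    using compact_Int_closedin[OF assms] C(2) by (metis Int_assoc)
qed

text \<open>By the finite intersection property it suffices to treat finite subfamilies, and in a
  decreasing chain the member with the largest index lies in all the others.\<close>

lemma compactin_chain_Inter_nonempty:
  fixes C :: "'o::linorder \<Rightarrow> 'a set"
  assumes "compactin T K" "I \<noteq> {}"
    and closed: "\<And>i. i \<in> I \<Longrightarrow> closedin T (C i)"
    and anti: "\<And>i j. i \<in> I \<Longrightarrow> j \<in> I \<Longrightarrow> i \<le> j \<Longrightarrow> K \<inter> C j \<subseteq> K \<inter> C i"
    and nonempty: "\<And>i. i \<in> I \<Longrightarrow> K \<inter> C i \<noteq> {}"
  shows "K \<inter> (\<Inter>i\<in>I. C i) \<noteq> {}"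
proof -
  have "K \<inter> \<Inter>\<F> \<noteq> {}" if \<F>: "finite \<F>" "\<F> \<subseteq> C ` I" for \<F>
  proof -
    obtain J where J: "finite J" "J \<subseteq> I" "\<F> = C ` J"
      using finite_subset_image[OF \<F>] by blast
    show ?thesis
    proof (cases "J = {}")
      case True
      then show ?thesis
        using J(3) \<open>I \<noteq> {}\<close> nonempty by auto
    next
      case False
      then have "K \<inter> C (Max J) \<subseteq> K \<inter> \<Inter>\<F>"
        using J anti[of _ "Max J"] Max_in[OF J(1)] Max_ge[OF J(1)] by blast
      then show ?thesis
        using nonempty[of "Max J"] Max_in[OF J(1) False] J(2) by blast
    qed
  qed
  then show ?thesis
    using assms(1) closed unfolding compactin_fip by (metis (no_types, lifting) imageE)
qed

text \<open>The witness may change with the ordinal, so only its existence is claimed. At limits the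
  witness sets form a decreasing chain of closed subsets of \<open>K\<close>, and compactness yields
  a common witness.\<close>

lemma nhds_of_iter_imp_szlenk_iter:
  fixes K :: "('a::real_normed_vector \<Rightarrow>\<^sub>L real) set" and \<xi> :: "'o::wellorder"
  assumes K: "compactin weak_star_topology K" and \<rho>: "\<rho> < \<epsilon> - \<delta>"
    and "t \<in> transfinite_iter (seq_deriv (nhds_of K \<delta>)) (H_tree K \<epsilon>) \<xi>"
  shows "transfinite_iter (szlenk_deriv \<rho>) K \<xi> \<inter> {f. \<forall>x\<in>set t. \<epsilon> \<le> blinfun_apply f x} \<noteq> {}"
  using assms(3)
proof (induction \<xi> arbitrary: t rule: wellorder_zero_succ_limit_induct)
  case (zero \<xi>)
  then show ?case
    by (auto simp: transfinite_iter_zero H_tree_def)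
next
  case (succ \<zeta> \<xi>)
  define S where "S = transfinite_iter (szlenk_deriv \<rho>) K \<zeta>"
  define G where "G = {f :: 'a \<Rightarrow>\<^sub>L real. \<forall>x\<in>set t. \<epsilon> \<le> blinfun_apply f x}"
  show ?case
  proof (rule ccontr)
    assume "\<not> ?case"
    then have empty: "szlenk_deriv \<rho> S \<inter> G = {}"
      by (simp add: transfinite_iter_succ[OF succ.hyps] S_def G_def)
    have "S \<inter> G \<subseteq> \<Union>{W. openin weak_star_topology W \<and> bounded (S \<inter> W) \<and> diameter (S \<inter> W) \<le> \<rho>}"
      using empty by (auto simp: szlenk_deriv_def)
    moreover have "compactin weak_star_topology (S \<inter> G)"
      unfolding S_def G_def by (rule compactin_szlenk_iter_ge[OF K])
    ultimately have "\<exists>\<W>. finite \<W> \<and> \<W> \<subseteq> {W. openin weak_star_topology W \<and>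
        bounded (S \<inter> W) \<and> diameter (S \<inter> W) \<le> \<rho>} \<and> S \<inter> G \<subseteq> \<Union>\<W>"
      by (intro compactinD) auto
    then obtain \<W> where \<W>: "finite \<W>" "S \<inter> G \<subseteq> \<Union>\<W>"
      "\<And>W. W \<in> \<W> \<Longrightarrow> bounded (S \<inter> W) \<and> diameter (S \<inter> W) \<le> \<rho>"
      by blast
    \<comment> \<open>\<open>p\<close> picks a representative of each piece
      \<open>S \<inter> W\<close>. Dropping the empty pieces puts all representatives in
      \<open>K\<close>, so that \<open>F\<close> defines a member of
      \<open>nhds_of K \<delta>\<close>.\<close>
    define p where "p W = (SOME f. f \<in> S \<inter> W)" for W
    have p: "p W \<in> S \<inter> W" if "f \<in> S \<inter> W" for f W
      unfolding p_def using that by (rule someI)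
    define F where "F = p ` {W \<in> \<W>. S \<inter> W \<noteq> {}}"
    have "S \<subseteq> K"
      unfolding S_def by (rule transfinite_iter_subset) (rule szlenk_deriv_subset)
    then have "finite F" "F \<subseteq> K"
      using \<W>(1) p by (auto simp: F_def)
    then have U: "{x. \<forall>f\<in>F. \<bar>blinfun_apply f x\<bar> < \<delta>} \<in> nhds_of K \<delta>"
      by (auto simp: nhds_of_def)
    have "t \<in> seq_deriv (nhds_of K \<delta>)
        (transfinite_iter (seq_deriv (nhds_of K \<delta>)) (H_tree K \<epsilon>) \<zeta>)"
      using succ.prems unfolding transfinite_iter_succ[OF succ.hyps] .
    from seq_derivD[OF this U] obtain y where y: "\<And>f. f \<in> F \<Longrightarrow> \<bar>blinfun_apply f y\<bar> < \<delta>"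
      "t @ [y] \<in> transfinite_iter (seq_deriv (nhds_of K \<delta>)) (H_tree K \<epsilon>) \<zeta>"
      by blast
    then obtain g where g: "g \<in> S" "\<And>x. x \<in> set (t @ [y]) \<Longrightarrow> \<epsilon> \<le> blinfun_apply g x"
      using succ.IH[of "t @ [y]"] by (auto simp: S_def)
    then obtain W where W: "W \<in> \<W>" "g \<in> W"
      using \<W>(2) by (auto simp: G_def)
    have "p W \<in> S \<inter> W" "p W \<in> F"
      using W g(1) p[of g W] by (auto simp: F_def)
    then have "dist g (p W) \<le> \<rho>"
      using diameter_bounded_bound[of "S \<inter> W" g "p W"] \<W>(3)[OF W(1)] W(2) g(1) by auto
    have "t @ [y] \<in> H_tree K \<epsilon>"
      using y(2) transfinite_iter_subset[of "seq_deriv (nhds_of K \<delta>)", OF seq_deriv_subset] by blast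
    then have "norm y \<le> 1"
      by (auto simp: H_tree_def)
    \<comment> \<open>The contradiction: at \<open>y\<close>, \<open>g\<close> is at least
      \<open>\<epsilon>\<close> and \<open>p W\<close> is below \<open>\<delta>\<close>, so
      \<open>g - p W\<close> exceeds \<open>\<epsilon> - \<delta> > \<rho>\<close> there, although
      its norm is at most \<open>\<rho>\<close> and \<open>y\<close> is in the ball.\<close>
    have "blinfun_apply (g - p W) y \<le> norm (g - p W) * norm y"
      using norm_blinfun[of "g - p W" y] by simp
    also have "\<dots> \<le> norm (g - p W)"
      using \<open>norm y \<le> 1\<close> by (simp add: mult_left_le)
    also have "\<dots> \<le> \<rho>"
      using \<open>dist g (p W) \<le> \<rho>\<close> by (simp add: dist_norm)
    finally show False
      using g(2)[of y] y(1)[OF \<open>p W \<in> F\<close>] \<rho> by (simp add: blinfun.diff_left)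
  qed
next
  case (limit \<xi>)
  define G where "G = {f :: 'a \<Rightarrow>\<^sub>L real. \<forall>x\<in>set t. \<epsilon> \<le> blinfun_apply f x}"
  obtain C where C: "\<And>\<zeta> :: 'o. closedin weak_star_topology (C \<zeta>)"
    "\<And>\<zeta> :: 'o. transfinite_iter (szlenk_deriv \<rho>) K \<zeta> = K \<inter> C \<zeta>"
    using szlenk_iter_closed[of \<rho> K] by metis
  have "K \<inter> (\<Inter>\<zeta>\<in>{..<\<xi>}. C \<zeta> \<inter> G) \<noteq> {}"
  proof (rule compactin_chain_Inter_nonempty[OF K limit.hyps(1)])
    show "closedin weak_star_topology (C \<zeta> \<inter> G)" for \<zeta>
      unfolding G_def using C(1) closedin_weak_star_ge by (rule closedin_Int)
    show "K \<inter> (C \<eta> \<inter> G) \<subseteq> K \<inter> (C \<zeta> \<inter> G)" if "\<zeta> \<le> \<eta>" for \<zeta> \<eta>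
      using transfinite_iter_antimono[of "szlenk_deriv \<rho>" \<zeta> \<eta> K, OF szlenk_deriv_subset that]
      by (auto simp: C(2))
    show "K \<inter> (C \<zeta> \<inter> G) \<noteq> {}" if "\<zeta> \<in> {..<\<xi>}" for \<zeta>
      using limit.IH[of \<zeta> t] limit.prems that
      by (auto simp: transfinite_iter_limit[OF limit.hyps] C(2) G_def)
  qed
  moreover have "transfinite_iter (szlenk_deriv \<rho>) K \<xi> \<inter> G = K \<inter> (\<Inter>\<zeta>\<in>{..<\<xi>}. C \<zeta> \<inter> G)"
    using limit.hyps(1) by (auto simp: transfinite_iter_limit[OF limit.hyps] C(2))
  ultimately show ?case
    by (simp add: G_def)
qed

section \<open>Comparison of the indices\<close>

text \<open>For the empty sequence the conditions on \<open>t\<close> are vacuous, so any point of a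
  Szlenk iterate puts \<open>[]\<close> into the corresponding iterate of the tree.\<close>

lemma less_Sz_eps_imp_less_weak_order:
  assumes "0 < \<epsilon>"
  shows "Sz_eps \<epsilon> K > Ord \<xi> \<Longrightarrow> weak_order (H_tree K (\<epsilon> / 8)) > Ord \<xi>"
  using szlenk_iter_imp_weak_iter[OF assms, where t = "[]"]
  unfolding Sz_eps_def weak_order_def seq_order_def Ord_less_vanishing_index by fastforce

text \<open>A derivation over a larger family asks for more extensions and keeps fewer sequences,
  and \<open>nhds_of K \<delta>\<close> consists of weak neighbourhoods of \<open>0\<close>.\<close>

lemma less_weak_order_imp_less_nhds_of_order:
  fixes \<xi> :: "'o::wellorder"
  assumes "0 < \<delta>"
  shows "weak_order H > Ord \<xi> \<Longrightarrow> seq_order (nhds_of K \<delta>) H > Ord \<xi>"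
proof -
  have "seq_deriv weak_nhds_zero B \<subseteq> seq_deriv (nhds_of K \<delta>) B" for B
    using nhds_of_subset_weak_nhds_zero[OF assms, of K] by (auto simp: seq_deriv_def)
  moreover have "mono (seq_deriv (nhds_of K \<delta>))"
    by (rule monoI) (fastforce simp: seq_deriv_def)
  ultimately have "transfinite_iter (seq_deriv weak_nhds_zero) H \<zeta>
      \<subseteq> transfinite_iter (seq_deriv (nhds_of K \<delta>)) H \<zeta>" for \<zeta> :: 'o
    by (rule transfinite_iter_mono)
  then show "weak_order H > Ord \<xi> \<Longrightarrow> seq_order (nhds_of K \<delta>) H > Ord \<xi>"
    unfolding weak_order_def seq_order_def Ord_less_vanishing_index by blast
qed

lemma less_nhds_of_order_imp_less_Sz_eps:
  assumes "compactin weak_star_topology K" "\<rho> < \<epsilon> - \<delta>"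
  shows "seq_order (nhds_of K \<delta>) (H_tree K \<epsilon>) > Ord \<xi> \<Longrightarrow> Sz_eps \<rho> K > Ord \<xi>"
  using nhds_of_iter_imp_szlenk_iter[OF assms]
  unfolding Sz_eps_def seq_order_def Ord_less_vanishing_index by blast

theorem theorem2p2:
  fixes K :: "('a::banach \<Rightarrow>\<^sub>L real) set" and \<xi> :: "'b ordinal"
  assumes "compactin weak_star_topology K" and "K \<noteq> {}"
  shows "((\<exists>\<epsilon>>0. Sz_eps \<epsilon> K > Ord \<xi>) \<longleftrightarrow> (\<exists>\<epsilon>>0. weak_order (H_tree K \<epsilon>) > Ord \<xi>))
    \<and> ((\<exists>\<epsilon>>0. weak_order (H_tree K \<epsilon>) > Ord \<xi>) \<longleftrightarrow>
       (\<exists>\<delta> \<epsilon>. 0 < \<delta> \<and> \<delta> < \<epsilon> \<and> seq_order (nhds_of K \<delta>) (H_tree K \<epsilon>) > Ord \<xi>))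
    \<and> (Sz K :: 'b ordinal extended_ord) = (SUP \<epsilon>\<in>{0<..}. weak_order (H_tree K \<epsilon>))
    \<and> (SUP \<epsilon>\<in>{0<..}. weak_order (H_tree K \<epsilon>) :: 'b ordinal extended_ord) =
       (SUP (\<delta>, \<epsilon>)\<in>{(\<delta>, \<epsilon>). 0 < \<delta> \<and> \<delta> < \<epsilon>}. seq_order (nhds_of K \<delta>) (H_tree K \<epsilon>))"
proof -
  \<comment> \<open>The three implications are proved for every \<open>\<xi>\<close>, since the
    equalities of suprema use them at all ordinals.\<close>
  have i_ii: "\<exists>\<epsilon>>0. weak_order (H_tree K \<epsilon>) > Ord \<xi>" if "\<exists>\<epsilon>>0. Sz_eps \<epsilon> K > Ord \<xi>"
    for \<xi> :: "'b ordinal"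
  proof -
    obtain \<epsilon> where "0 < \<epsilon>" "Sz_eps \<epsilon> K > Ord \<xi>"
      using \<open>\<exists>\<epsilon>>0. Sz_eps \<epsilon> K > Ord \<xi>\<close> by blast
    then show ?thesis
      using less_Sz_eps_imp_less_weak_order by (intro exI[of _ "\<epsilon> / 8"]) auto
  qed
  have ii_iii: "\<exists>\<delta> \<epsilon>. 0 < \<delta> \<and> \<delta> < \<epsilon> \<and> seq_order (nhds_of K \<delta>) (H_tree K \<epsilon>) > Ord \<xi>"
    if "\<exists>\<epsilon>>0. weak_order (H_tree K \<epsilon>) > Ord \<xi>" for \<xi> :: "'b ordinal"
    \<comment> \<open>Any \<open>\<delta>\<close> strictly between \<open>0\<close> and
      \<open>\<epsilon>\<close> serves.\<close>
    using that less_weak_order_imp_less_nhds_of_order by (meson dense)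
  have iii_i: "\<exists>\<epsilon>>0. Sz_eps \<epsilon> K > Ord \<xi>"
    if "\<exists>\<delta> \<epsilon>. 0 < \<delta> \<and> \<delta> < \<epsilon> \<and> seq_order (nhds_of K \<delta>) (H_tree K \<epsilon>) > Ord \<xi>"
    for \<xi> :: "'b ordinal"
    \<comment> \<open>The new constant is any number strictly between \<open>0\<close> and
      \<open>\<epsilon> - \<delta>\<close>.\<close>
    using that less_nhds_of_order_imp_less_Sz_eps[OF assms(1)] by (meson dense diff_gt_0_iff_gt)
  have "Sz K = (SUP \<epsilon>\<in>{0<..}. weak_order (H_tree K \<epsilon>) :: 'b ordinal extended_ord)"
    unfolding Sz_def
  proof (rule extended_ord_eqI)
    show "Ord \<xi> < (SUP \<epsilon>\<in>{0<..}. Sz_eps \<epsilon> K) \<longleftrightarrow>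
      Ord \<xi> < (SUP \<epsilon>\<in>{0<..}. weak_order (H_tree K \<epsilon>))" for \<xi> :: "'b ordinal"
      \<comment> \<open>In a complete linear order an element is below a supremum exactly when it is
        below some member, which turns both sides into (i) and (ii).\<close>
      using i_ii[of \<xi>] ii_iii[of \<xi>] iii_i[of \<xi>] by (auto simp: less_SUP_iff)
  qed
  moreover have "(SUP \<epsilon>\<in>{0<..}. weak_order (H_tree K \<epsilon>) :: 'b ordinal extended_ord) =
      (SUP (\<delta>, \<epsilon>)\<in>{(\<delta>, \<epsilon>). 0 < \<delta> \<and> \<delta> < \<epsilon>}. seq_order (nhds_of K \<delta>) (H_tree K \<epsilon>))"
  proof (rule extended_ord_eqI)
    show "Ord \<xi> < (SUP \<epsilon>\<in>{0<..}. weak_order (H_tree K \<epsilon>)) \<longleftrightarrow>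
      Ord \<xi> < (SUP (\<delta>, \<epsilon>)\<in>{(\<delta>, \<epsilon>). 0 < \<delta> \<and> \<delta> < \<epsilon>}. seq_order (nhds_of K \<delta>) (H_tree K \<epsilon>))"
      for \<xi> :: "'b ordinal"
      using i_ii[of \<xi>] ii_iii[of \<xi>] iii_i[of \<xi>] by (auto simp: less_SUP_iff)
  qed
  ultimately show ?thesis
    using i_ii[of \<xi>] ii_iii[of \<xi>] iii_i[of \<xi>] by blast
qed

end
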